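(* Let $a=2^s$ with $s\ge1$ an integer, let $q=2^a+1$ be a Fermat prime, and let $p$ be a prime divisor of $2^a-1$. Suppose that $p=2^{2^l}+1$ is a Fermat prime for some $0\le l\le s-1$. Then the independence number of $\Gamma(a,p,\emptyset,\{0\})$ satisfies $\alpha(\Gamma(a,p,\emptyset,\{0\}))\le q$, with equality only if $l=s-1$ (that is, $p=2^{2^{s-1}}+1$).
   Context: $\Gamma(a,p,\emptyset,\{0\})$ is the Marušič-Scapellato graph with vertex set $(\mathrm{GF}(2^a)\cup\{\infty\})\times\mathbb{Z}_p$ in which, for a primitive element $w$ of $\mathrm{GF}(2^a)$, the neighbourhood of $(\infty,r)$ is $\{(x,r):x\in\mathrm{GF}(2^a)\}$, and the neighbourhood of $(x,r)$ with $x\in\mathrm{GF}(2^a)$ is $\{(\infty,r)\}\cup\{(x+w^i,-r+2i):i\in\mathbb{Z}_{2^a-1}\}$. *)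

theory Defs
  imports
    "HOL-Library.Cardinality"
    "HOL-Number_Theory.Residues"
    "Graph_Theory.Pair_Digraph"
begin

definition fermat_prime :: "nat \<Rightarrow> bool" where
  "fermat_prime n \<longleftrightarrow> prime n \<and> (\<exists>k. n = 2 ^ (2 ^ k) + 1)"

definition primitive_element :: "'k::{field,finite} \<Rightarrow> bool" where
  "primitive_element w \<longleftrightarrow> range (\<lambda>i::nat. w ^ i) = UNIV - {0}"

text \<open>An undirected simple graph is a \<^locale>\<open>pair_graph\<close>: finite, loop-free, with a symmetric
  arc relation.\<close>

definition independent_set :: "'v pair_pre_digraph \<Rightarrow> 'v set \<Rightarrow> bool" where
  "independent_set G S \<longleftrightarrow> S \<subseteq> pverts G \<and> (\<forall>u\<in>S. \<forall>v\<in>S. (u, v) \<notin> parcs G)"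

definition independence_number :: "'v pair_pre_digraph \<Rightarrow> nat" where
  "independence_number G = Max (card ` {S. independent_set G S})"

text \<open>The field with \<^term>\<open>2 ^ a\<close> elements is the type \<^typ>\<open>'k\<close>, and \<^term>\<open>None\<close> is the point at
  infinity.  The group of integers modulo \<^term>\<open>p\<close> is represented by the residues
  \<^term>\<open>{0..<int p}\<close>.  The exponent \<^term>\<open>i\<close> runs over the residues modulo \<^term>\<open>2 ^ a - 1\<close>; the
  class of \<^term>\<open>2 * i\<close> modulo \<^term>\<open>p\<close> does not depend on the representative, as
  \<^term>\<open>p dvd 2 ^ a - 1\<close> in the case of interest.\<close>

definition ms_vertices :: "nat \<Rightarrow> ('k::{field,finite} option \<times> int) set" where
  "ms_vertices p = UNIV \<times> {0..<int p}"

fun ms_neighbourhood ::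
    "nat \<Rightarrow> nat \<Rightarrow> 'k::{field,finite} \<Rightarrow> 'k option \<times> int \<Rightarrow> ('k option \<times> int) set" where
  "ms_neighbourhood a p w (None, r) = {(Some x, r) | x. True}"
| "ms_neighbourhood a p w (Some x, r) =
     {(None, r)} \<union> {(Some (x + w ^ i), (- r + 2 * int i) mod int p) | i. i < 2 ^ a - 1}"

text \<open>The graph written as Gamma with parameters a, p, the empty set and the singleton of 0.\<close>

definition ms_graph ::
    "nat \<Rightarrow> nat \<Rightarrow> 'k::{field,finite} \<Rightarrow> ('k option \<times> int) pair_pre_digraph" where
  "ms_graph a p w =
     \<lparr> pverts = ms_vertices p,
       parcs = {(u, v). u \<in> ms_vertices p \<and> v \<in> ms_neighbourhood a p w u} \<rparr>"

lemma ms_graph_pair_graph: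
  fixes w :: "'k::{field,finite}"
  assumes card: "CARD('k) = 2 ^ a" and w: "primitive_element w" and p: "p > 0"
  shows "pair_graph (ms_graph a p w)"
proof -
  have "CHAR('k) dvd 2 ^ a"
    using CHAR_dvd_CARD[where 'a = 'k] card by simp
  moreover have "prime CHAR('k)"
    by (intro prime_CHAR_semidom finite_imp_CHAR_pos) auto
  ultimately have "CHAR('k) dvd 2"
    using prime_dvd_power by blast
  then have "of_nat 2 = (0 :: 'k)"
    by (simp only: of_nat_eq_0_iff_char_dvd)
  then have two: "x + x = 0" for x :: 'k
    by (metis mult_2 mult_zero_left of_nat_numeral)
  then have cancel: "x + y + y = x" for x y :: 'k
    by (simp add: add.assoc)
  have "w \<noteq> 0"
  proof
    assume "w = 0"
    moreover have "w ^ 1 \<in> UNIV - {0}"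
      using w unfolding primitive_element_def by blast
    ultimately show False by simp
  qed
  have resid: "(- ((- r + 2 * int i) mod int p) + 2 * int i) mod int p = r"
    if "0 \<le> r" "r < int p" for r i
  proof -
    have "(- ((- r + 2 * int i) mod int p) + 2 * int i) mod int p
        = (- (- r + 2 * int i) + 2 * int i) mod int p"
      by (intro mod_add_cong mod_minus_cong) auto
    then show ?thesis using that by simp
  qed
  have nbs: "ms_neighbourhood a p w u \<subseteq> ms_vertices p - {u}" if "u \<in> ms_vertices p" for u
  proof -
    obtain x r where "u = (x, r)" by fastforce
    then show ?thesis
      using that p \<open>w \<noteq> 0\<close> by (cases x) (auto simp: ms_vertices_def)
  qed
  have wf: "fst e \<in> ms_vertices p \<and> snd e \<in> ms_vertices p \<and> fst e \<noteq> snd e"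
    if "e \<in> parcs (ms_graph a p w)" for e
    using that nbs by (fastforce simp: ms_graph_def)
  have sym: "(v, u) \<in> parcs (ms_graph a p w)" if uv: "(u, v) \<in> parcs (ms_graph a p w)" for u v
  proof -
    obtain x r y s where uv_eq [simp]: "u = (x, r)" "v = (y, s)" by fastforce
    have "u \<in> ms_vertices p" "v \<in> ms_vertices p" using wf[OF uv] by auto
    then have "0 \<le> r" "r < int p" "0 \<le> s" "s < int p"
      by (auto simp: ms_vertices_def)
    note range = this
    have nb: "v \<in> ms_neighbourhood a p w u" using uv by (simp add: ms_graph_def)
    have "u \<in> ms_neighbourhood a p w v"
    proof (cases "x = None \<or> y = None")
      case True
      then show ?thesis using nb by (cases x) auto
    next
      case False
      then obtain x' y' where x: "x = Some x'" and y: "y = Some y'" by auto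
      from nb x y obtain i where i: "i < 2 ^ a - 1" "y' = x' + w ^ i"
          "s = (- r + 2 * int i) mod int p"
        by auto
      have "x' = y' + w ^ i"
        by (simp only: i(2) cancel)
      moreover have "r = (- s + 2 * int i) mod int p"
        using resid[OF range(1,2), of i] by (simp only: i(3))
      ultimately have "(Some x', r) \<in> ms_neighbourhood a p w (Some y', s)"
        unfolding ms_neighbourhood.simps using i(1) by blast
      then show ?thesis by (simp only: x y uv_eq)
    qed
    then show ?thesis
      using wf[OF uv] by (simp add: ms_graph_def)
  qed
  have fin: "finite (ms_vertices p :: ('k option \<times> int) set)"
    by (simp add: ms_vertices_def)
  have "parcs (ms_graph a p w) \<subseteq> ms_vertices p \<times> ms_vertices p"
    using wf by (auto simp: mem_Times_iff)
  then have "finite (parcs (ms_graph a p w))"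
    using fin by (meson finite_SigmaI finite_subset)
  moreover have "finite (pverts (ms_graph a p w))"
    by (simp add: ms_graph_def fin)
  moreover have "symmetric (with_proj (ms_graph a p w))"
    unfolding symmetric_def with_proj_simps sym_def using sym by blast
  moreover have "pverts (ms_graph a p w) = ms_vertices p"
    by (simp add: ms_graph_def)
  ultimately show ?thesis
    using wf by unfold_locales (simp_all only: not_False_eq_True)
qed

end

theory Submission
  imports Defs
begin

text \<open>
  Write \<open>a = 2 b g\<close> with \<open>b = 2 ^ l\<close>, so that \<open>F = GF(2 ^ a)\<close> contains \<open>K = GF(2 ^ b)\<close> and
  \<open>L = GF(2 ^ (2 b))\<close>, and let \<open>d (w ^ i) = 2 i mod p\<close>.  Finite points \<open>(x, r)\<close> and \<open>(y, t)\<close> are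
  adjacent iff \<open>x \<noteq> y\<close> and \<open>d (x - y) = r + t\<close>, so the layer \<open>r\<close> of an independent set has no
  difference with \<open>d = 2 r\<close>.  Since \<open>d\<close> vanishes on \<open>K - {0}\<close>, such a layer \<open>T\<close> meets every
  translate of a line \<open>c K\<close> with \<open>d c = 2 r\<close> at most once; hence \<open>|T| \<le> 2 ^ (a - b)\<close>.
  An automorphism moves some point of the independent set to \<open>(\<infinity>, r)\<close>, which empties the layer \<open>r\<close>,
  and the remaining \<open>p - 1 = 2 ^ b\<close> layers give the bound \<open>1 + 2 ^ b 2 ^ (a - b) = q\<close>.

  Equality needs a layer with \<open>2 ^ (a - b)\<close> points.  As \<open>d\<close> maps \<open>L - {0}\<close> onto the residues
  modulo \<open>p\<close>, every affine \<open>L\<close>-line is tiled by translates of such \<open>c K\<close> and therefore meets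
  \<open>T\<close> in exactly \<open>2 ^ b\<close> points.  Counting \<open>T\<close> along the \<open>L\<close>-lines through one of its points gives
  \<open>(|T| - 1) (2 ^ b + 1) = 2 ^ a - 1\<close>, which forces \<open>g = 1\<close>.
\<close>

section \<open>Powers of a primitive element of a finite field\<close>

lemma primitive_element_nonzero:
  "w \<noteq> 0" if "primitive_element w"
proof
  assume "w = 0"
  moreover have "w ^ 1 \<in> UNIV - {0}"
    using that unfolding primitive_element_def by blast
  ultimately show False by simp
qed

lemma primitive_element_power_exists:
  assumes "primitive_element w" "x \<noteq> 0"
  shows "\<exists>i. w ^ i = x"
proof -
  have "x \<in> range (\<lambda>i::nat. w ^ i)"
    using assms by (simp add: primitive_element_def)
  then show ?thesis by auto
qed

text \<open>The order of \<open>w\<close> is exactly the number of nonzero elements: a smaller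
  positive period would leave too few powers to cover them.\<close>

lemma primitive_element_power_eq_1_iff:
  fixes w :: "'k::{field,finite}"
  assumes w: "primitive_element w"
  shows "w ^ n = 1 \<longleftrightarrow> CARD('k) - 1 dvd n"
proof -
  define m where "m = CARD('k) - 1"
  have w0: "w \<noteq> 0" using w by (rule primitive_element_nonzero)
  have range: "range (\<lambda>i::nat. w ^ i) = UNIV - {0}"
    using w by (simp add: primitive_element_def)
  have card_range: "card (range (\<lambda>i::nat. w ^ i)) = m"
    by (simp add: range m_def card_Diff_subset)
  have low: "m \<le> k" if "w ^ k = 1" "0 < k" for k
  proof -
    have "w ^ i \<in> (\<lambda>i. w ^ i) ` {..<k}" for i
    proof -
      have "w ^ i = w ^ (k * (i div k) + i mod k)" by simp
      also have "\<dots> = w ^ (i mod k)"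
        using that(1) by (simp only: power_add power_mult power_one mult_1)
      finally show ?thesis using that(2) by auto
    qed
    then have "range (\<lambda>i. w ^ i) \<subseteq> (\<lambda>i. w ^ i) ` {..<k}" by blast
    then have "m \<le> card ((\<lambda>i. w ^ i) ` {..<k})"
      using card_mono[of "(\<lambda>i. w ^ i) ` {..<k}"] card_range by auto
    also have "\<dots> \<le> k"
      using card_image_le[of "{..<k}" "\<lambda>i. w ^ i"] by simp
    finally show ?thesis .
  qed
  \<comment> \<open>Pigeonhole: \<open>m + 1\<close> exponents but only \<open>m\<close> nonzero
    elements. The resulting period \<open>j - i\<close> is at most \<open>m\<close>, so by
    \<open>low\<close> it equals \<open>m\<close>.\<close>
  have "\<not> inj_on (\<lambda>i. w ^ i) {..m}"
  proof
    assume "inj_on (\<lambda>i. w ^ i) {..m}"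
    then have "card ((\<lambda>i. w ^ i) ` {..m}) = Suc m" by (simp add: card_image)
    moreover have "card ((\<lambda>i. w ^ i) ` {..m}) \<le> m"
      using card_mono[of "range (\<lambda>i. w ^ i)" "(\<lambda>i. w ^ i) ` {..m}"] card_range by auto
    ultimately show False by simp
  qed
  then obtain i j where ij: "i < j" "j \<le> m" "w ^ i = w ^ j"
    unfolding inj_on_def by (metis atMost_iff linorder_neqE_nat)
  have "w ^ (j - i) = 1"
    using ij w0 by (simp add: power_diff)
  then have "m \<le> j - i" using low ij(1) by simp
  then have "j - i = m" using ij by simp
  then have one: "w ^ m = 1" and "0 < m"
    using \<open>w ^ (j - i) = 1\<close> ij(1) by auto
  have "w ^ n = w ^ (m * (n div m) + n mod m)" by simp
  also have "\<dots> = w ^ (n mod m)"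
    using one by (simp only: power_add power_mult power_one mult_1)
  finally have "w ^ n = w ^ (n mod m)" .
  then have "w ^ n = 1 \<longleftrightarrow> n mod m = 0"
    using low[of "n mod m"] \<open>0 < m\<close> by (metis mod_less_divisor not_gr_zero not_le power_0)
  then show ?thesis by (simp add: m_def dvd_eq_mod_eq_0)
qed

lemma primitive_element_power_eq_iff:
  fixes w :: "'k::{field,finite}"
  assumes w: "primitive_element w"
  shows "w ^ i = w ^ j \<longleftrightarrow> [i = j] (mod CARD('k) - 1)"
proof (induction i j rule: linorder_wlog)
  case (le i j)
  have "w ^ i = w ^ j \<longleftrightarrow> w ^ (j - i) = 1"
    using primitive_element_nonzero[OF w] le by (auto simp: power_diff)
  then show ?case
    using le by (metis primitive_element_power_eq_1_iff[OF w] cong_altdef_nat cong_sym_eq)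
next
  case (sym i j)
  then show ?case by (metis cong_sym_eq)
qed

text \<open>For \<open>x = w ^ j\<close> the equation says that the order \<open>M * (N - 1)\<close>
  of \<open>w\<close> divides \<open>j * (N - 1)\<close>, that is, \<open>M\<close> divides
  \<open>j\<close>. This yields the subfields \<open>K\<close> and \<open>L\<close> with their
  sizes.\<close>

lemma power_fixed_points:
  fixes w :: "'k::{field,finite}"
  assumes w: "primitive_element w" and N: "1 < N" and MN: "M * (N - 1) = CARD('k) - 1"
  shows "x ^ N = x \<longleftrightarrow> x = 0 \<or> (\<exists>i. x = w ^ (M * i))"
    and "card {x::'k. x ^ N = x} = N"
proof -
  have card2: "1 < CARD('k)"
    using card_mono[of UNIV "{0, 1::'k}"] by simp
  then have "M * (N - 1) > 0" using MN by simp
  then have M: "M > 0" by simp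
  note pw = primitive_element_power_eq_iff[OF w, folded MN]
  have nz: "x ^ N = x \<longleftrightarrow> (\<exists>i. x = w ^ (M * i))" if "x \<noteq> 0" for x
  proof -
    obtain j where j: "x = w ^ j"
      using primitive_element_power_exists[OF w \<open>x \<noteq> 0\<close>] by metis
    have "x ^ N = x \<longleftrightarrow> x ^ (N - 1) = 1"
      using that N by (cases N) auto
    also have "\<dots> \<longleftrightarrow> M * (N - 1) dvd j * (N - 1)"
      unfolding j MN by (simp only: primitive_element_power_eq_1_iff[OF w] flip: power_mult)
    also have "\<dots> \<longleftrightarrow> M dvd j" using N by simp
    also have "\<dots> \<longleftrightarrow> (\<exists>i. x = w ^ (M * i))"
    proof
      assume "\<exists>i. x = w ^ (M * i)"
      then obtain i where "w ^ j = w ^ (M * i)" unfolding j by (elim exE)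
      then have "[j = M * i] (mod M * (N - 1))" by (simp only: pw)
      then have "[j = M * i] (mod M)" by (rule cong_dvd_modulus_nat) simp
      then show "M dvd j" by (simp add: cong_def mod_eq_0_iff_dvd)
    qed (auto simp: j)
    finally show ?thesis .
  qed
  show iff: "x ^ N = x \<longleftrightarrow> x = 0 \<or> (\<exists>i. x = w ^ (M * i))" for x
    using nz[of x] N by (cases "x = 0") auto
  have "{x::'k. x ^ N = x} = insert 0 ((\<lambda>i. w ^ (M * i)) ` {..<N - 1})"
  proof (intro equalityI subsetI)
    fix x :: 'k assume x: "x \<in> {x. x ^ N = x}"
    show "x \<in> insert 0 ((\<lambda>i. w ^ (M * i)) ` {..<N - 1})"
    proof (cases "x = 0")
      case False
      then obtain i where i: "x = w ^ (M * i)" using x iff[of x] by auto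
      have "[M * i = M * (i mod (N - 1))] (mod M * (N - 1))"
        by (simp only: cong_def mult_mod_right mod_mod_trivial)
      then have "x = w ^ (M * (i mod (N - 1)))" by (simp add: i pw)
      moreover have "i mod (N - 1) < N - 1" using N by simp
      ultimately show ?thesis by blast
    qed simp
  qed (use iff in auto)
  moreover have "inj_on (\<lambda>i. w ^ (M * i)) {..<N - 1}"
  proof (rule inj_onI)
    fix i j assume ij: "i \<in> {..<N - 1}" "j \<in> {..<N - 1}" "w ^ (M * i) = w ^ (M * j)"
    then have "[M * i = M * j] (mod M * (N - 1))" by (simp add: pw)
    moreover have "M * i < M * (N - 1)" "M * j < M * (N - 1)" using ij M by auto
    ultimately have "M * i = M * j" by (rule cong_less_modulus_unique_nat)
    then show "i = j" using M by simp
  qed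
  moreover have "0 \<notin> (\<lambda>i. w ^ (M * i)) ` {..<N - 1}"
    using primitive_element_nonzero[OF w] by auto
  ultimately show "card {x::'k. x ^ N = x} = N"
    using N by (simp add: card_image)
qed

section \<open>Characteristic 2 and the arithmetic of the field tower\<close>

locale ms_field =
  fixes w :: "'k::{field,finite}" and b g p :: nat
  assumes w: "primitive_element w"
    and b: "0 < b" and g: "0 < g"
    and card_field: "CARD('k) = 2 ^ (2 * b * g)"
    and p_eq: "p = 2 ^ b + 1"
    and coprime_g: "coprime g p"
begin

text \<open>The paper's \<open>a\<close> is \<open>2 * b * g\<close>; thus \<open>g\<close> is the degree of the field over \<open>GF(2 ^ (2 * b))\<close>.\<close>

lemma prime_CHAR: "prime CHAR('k)"
  by (intro prime_CHAR_semidom finite_imp_CHAR_pos) auto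

lemma CHAR_eq: "CHAR('k) = 2"
proof -
  have "CHAR('k) dvd 2 ^ (2 * b * g)"
    using CHAR_dvd_CARD[where 'a = 'k] card_field by simp
  then have "CHAR('k) dvd 2"
    using prime_CHAR prime_dvd_power by blast
  then show ?thesis
    using prime_CHAR two_is_prime_nat primes_dvd_imp_eq by blast
qed

lemma uminus_char2: "- x = (x :: 'k)"
proof -
  have "of_nat 2 = (0 :: 'k)"
    by (simp only: of_nat_eq_0_iff_char_dvd CHAR_eq dvd_refl)
  then have "x + x = 0"
    by (metis mult_2 mult_zero_left of_nat_numeral)
  then show ?thesis by (simp add: add_eq_0_iff)
qed

lemma p_odd: "odd p"
  using b by (simp add: p_eq)

lemma p_gt1: "1 < p"
  by (simp add: p_eq)

lemma field_sizes_gt1: "1 < (2::nat) ^ b" "1 < (2::nat) ^ (2 * b)" "1 < (2::nat) ^ (2 * b * g)"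
  using b g by (intro one_less_power; simp)+

lemma frobenius_add: "(x + y :: 'k) ^ (2 ^ n) = x ^ (2 ^ n) + y ^ (2 ^ n)"
  by (rule freshmans_dream'[OF prime_CHAR]) (simp add: CHAR_eq)

text \<open>\<open>w ^ M\<close> generates the multiplicative group of \<open>L\<close>, and \<open>w ^ (M * p)\<close> that of \<open>K\<close>.\<close>

definition M where "M = (\<Sum>i<g. (2 ^ (2 * b)) ^ i :: nat)"

lemma M_mult: "M * (2 ^ (2 * b) - 1) = 2 ^ (2 * b * g) - 1"
proof -
  have "int (M * (2 ^ (2 * b) - 1)) = int (2 ^ (2 * b * g) - 1)"
    using power_diff_1_eq[of "2 ^ (2 * b) :: int" g]
    by (simp add: M_def of_nat_diff mult.commute flip: power_mult)
  then show ?thesis by (simp only: of_nat_eq_iff)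
qed

lemma square_minus_one: "2 ^ (2 * b) - 1 = p * (2 ^ b - 1 :: nat)"
proof -
  have "int (2 ^ (2 * b) - 1) = int (p * (2 ^ b - 1))"
    by (simp add: p_eq of_nat_diff mult_2 power_add) (simp add: algebra_simps)
  then show ?thesis by (simp only: of_nat_eq_iff)
qed

lemma Mp_mult: "M * p * (2 ^ b - 1) = 2 ^ (2 * b * g) - 1"
  using M_mult square_minus_one by (simp add: mult.assoc)

lemma p_dvd: "p dvd 2 ^ (2 * b * g) - 1"
  by (metis Mp_mult dvd_triv_left dvd_mult dvd_mult2 dvd_refl)

text \<open>Since \<open>2 ^ (2 * b)\<close> is 1 modulo \<open>p\<close>, every term of the sum is
  1 and \<open>M\<close> is congruent to \<open>g\<close>.\<close>

lemma coprime_M: "coprime M p"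
proof -
  have "[2 ^ (2 * b) - 1 = 0] (mod p)"
    unfolding square_minus_one by (simp add: cong_0_iff)
  then have "[2 ^ (2 * b) - 1 + 1 = 0 + 1] (mod p)"
    by (intro cong_add) auto
  then have one: "[2 ^ (2 * b) = 1] (mod p)" by simp
  have "[M = (\<Sum>i<g. 1 ^ i)] (mod p)"
    unfolding M_def by (intro cong_sum cong_pow one)
  then have "[M = g] (mod p)" by simp
  then show ?thesis
    using coprime_g cong_imp_coprime cong_sym by blast
qed

section \<open>Logarithmic labels modulo \<open>p\<close>\<close>

text \<open>Only the residue of \<open>dl x\<close> modulo \<open>p\<close> is meaningful, and only for \<open>x \<noteq> 0\<close>.\<close>

definition dl :: "'k \<Rightarrow> int" where
  "dl x = 2 * int (SOME i. w ^ i = x)"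

lemma power_exists_less: "x \<noteq> 0 \<Longrightarrow> \<exists>i < 2 ^ (2 * b * g) - 1. w ^ i = x"
proof -
  assume "x \<noteq> 0"
  then obtain i where i: "w ^ i = x" using primitive_element_power_exists[OF w] by blast
  have "2 ^ (2 * b * g) - 1 > (0::nat)" using field_sizes_gt1 by simp
  moreover have "w ^ (i mod (2 ^ (2 * b * g) - 1)) = w ^ i"
    by (simp add: primitive_element_power_eq_iff[OF w] card_field cong_def)
  ultimately show ?thesis using i by (metis mod_less_divisor)
qed

lemma dl_power: "[dl (w ^ i) = 2 * int i] (mod int p)"
proof -
  define j where "j = (SOME j. w ^ j = w ^ i)"
  have "w ^ j = w ^ i" unfolding j_def by (rule someI) simp
  then have "[j = i] (mod 2 ^ (2 * b * g) - 1)"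
    by (simp add: primitive_element_power_eq_iff[OF w] card_field)
  then have "[j = i] (mod p)" using p_dvd cong_dvd_modulus_nat by blast
  then show ?thesis
    by (simp add: dl_def j_def[symmetric] cong_int_iff cong_mult)
qed

lemma dl_mult:
  assumes "x \<noteq> 0" "y \<noteq> 0"
  shows "[dl (x * y) = dl x + dl y] (mod int p)"
proof -
  obtain i j where ij: "x = w ^ i" "y = w ^ j" using assms primitive_element_power_exists[OF w] by metis
  have "[dl (x * y) = 2 * int (i + j)] (mod int p)"
    using dl_power[of "i + j"] by (simp add: ij power_add)
  moreover have "[dl x + dl y = 2 * int i + 2 * int j] (mod int p)"
    unfolding ij by (intro cong_add dl_power)
  ultimately show ?thesis by (simp add: cong_def)
qed

text \<open>Every direction \<open>z\<close> can be rescaled inside its own \<open>L\<close>-line to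
  have a prescribed label, because \<open>w ^ M\<close> has label \<open>2 * M\<close>, a unit
  modulo \<open>p\<close>.\<close>

lemma dl_surj:
  assumes "z \<noteq> 0"
  shows "\<exists>\<mu>. \<mu> \<noteq> 0 \<and> \<mu> ^ (2 ^ (2 * b)) = \<mu> \<and> [dl (\<mu> * z) = e] (mod int p)"
proof -
  have "coprime (2 * int M) (int p)"
    using coprime_M p_odd by (simp add: coprime_iff_gcd_eq_1[symmetric])
  then obtain u where u: "[2 * int M * u = 1] (mod int p)"
    using cong_solve_coprime_int by blast
  define i where "i = nat ((u * (e - dl z)) mod int p)"
  have i: "[int i = u * (e - dl z)] (mod int p)"
    using p_gt1 by (simp add: i_def)
  define \<mu> where "\<mu> = w ^ (M * i)"
  have 0: "\<mu> \<noteq> 0" using primitive_element_nonzero[OF w] by (simp add: \<mu>_def)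
  have "[dl \<mu> = 2 * int M * int i] (mod int p)"
    using dl_power[of "M * i"] by (simp add: \<mu>_def mult.assoc)
  also have "[2 * int M * int i = 2 * int M * (u * (e - dl z))] (mod int p)"
    by (intro cong_mult cong_refl i)
  also have "[2 * int M * (u * (e - dl z)) = 1 * (e - dl z)] (mod int p)"
    using cong_mult[OF u cong_refl[of "e - dl z"]] by (simp add: mult.assoc)
  finally have "[dl \<mu> + dl z = 1 * (e - dl z) + dl z] (mod int p)"
    by (intro cong_add cong_refl)
  then have "[dl (\<mu> * z) = e] (mod int p)"
    using dl_mult[OF 0 assms] cong_trans by fastforce
  moreover have "\<mu> ^ (2 ^ (2 * b)) = \<mu>"
    using power_fixed_points(1)[OF w, of "2 ^ (2 * b)" M \<mu>] field_sizes_gt1 M_mult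
    by (auto simp: card_field \<mu>_def)
  ultimately show ?thesis using 0 by blast
qed

section \<open>The subfields \<open>K\<close> and \<open>L\<close>\<close>

abbreviation "K \<equiv> {x::'k. x ^ (2 ^ b) = x}"
abbreviation "L \<equiv> {x::'k. x ^ (2 ^ (2 * b)) = x}"

lemma card_K: "card K = 2 ^ b"
  using power_fixed_points(2)[OF w, of "2 ^ b" "M * p"] field_sizes_gt1 Mp_mult by (simp add: card_field)

lemma card_L: "card L = 2 ^ (2 * b)"
  using power_fixed_points(2)[OF w, of "2 ^ (2 * b)" M] field_sizes_gt1 M_mult by (simp add: card_field)

lemma K_subset_L: "K \<subseteq> L"
  by (auto simp: mult_2 power_add power_mult)

text \<open>Nonzero elements of \<open>K\<close> are powers of \<open>w ^ (M * p)\<close>, so their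
  exponents are multiples of \<open>p\<close>.\<close>

lemma dl_K:
  assumes "k \<in> K" "k \<noteq> 0"
  shows "[dl k = 0] (mod int p)"
proof -
  obtain i where i: "k = w ^ (M * p * i)"
    using power_fixed_points(1)[OF w, of "2 ^ b" "M * p" k] field_sizes_gt1 Mp_mult assms by (auto simp: card_field)
  show ?thesis
    using dl_power[of "M * p * i"] unfolding i by (simp add: cong_def mult.assoc mult.left_commute)
qed

lemma diff_K: "x \<in> K \<Longrightarrow> y \<in> K \<Longrightarrow> x - y \<in> K"
  using frobenius_add[of x "y" b] by (metis (mono_tags) diff_conv_add_uminus mem_Collect_eq uminus_char2)

lemma add_L: "x \<in> L \<Longrightarrow> y \<in> L \<Longrightarrow> x + y \<in> L"
  by (simp add: frobenius_add)

lemma mult_L: "x \<in> L \<Longrightarrow> y \<in> L \<Longrightarrow> x * y \<in> L"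
  by (simp add: power_mult_distrib)

section \<open>Sets without differences of a given label\<close>

text \<open>These are the independent sets of the Cayley graph on the additive group whose
  connection set is one label class.\<close>

definition class_free :: "int \<Rightarrow> 'k set \<Rightarrow> bool" where
  "class_free e T \<longleftrightarrow> (\<forall>x\<in>T. \<forall>y\<in>T. x \<noteq> y \<longrightarrow> \<not> [dl (x - y) = e] (mod int p))"

text \<open>A collision gives \<open>x - x' = c * (k' - k)\<close>; the factor from \<open>K\<close>
  has label 0, so the difference would have the forbidden label of \<open>c\<close>.\<close>

lemma class_free_inj:
  assumes T: "class_free e T" and c: "c \<noteq> 0" "[dl c = e] (mod int p)"
  shows "inj_on (\<lambda>(x, k). x + c * k) (T \<times> K)"
proof (rule inj_onI, clarify)
  fix x k x' k' assume x: "x \<in> T" "x' \<in> T" and k: "k ^ (2 ^ b) = k" "k' ^ (2 ^ b) = k'"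
    and eq: "x + c * k = x' + c * k'"
  have xx: "x - x' = c * (k' - k)" using eq by (simp add: algebra_simps)
  show "x = x' \<and> k = k'"
  proof (rule ccontr)
    assume "\<not> ?thesis"
    then have ne: "x \<noteq> x'" "k' - k \<noteq> 0" using eq c by auto
    have "[dl (x - x') = dl c + dl (k' - k)] (mod int p)"
      unfolding xx by (rule dl_mult[OF c(1) ne(2)])
    also have "[dl c + dl (k' - k) = e + 0] (mod int p)"
      using diff_K[of k' k] k ne(2) by (intro cong_add c(2) dl_K) auto
    finally show False using T x ne(1) by (auto simp: class_free_def)
  qed
qed

lemma class_free_card:
  assumes T: "class_free e T"
  shows "card T * 2 ^ b \<le> 2 ^ (2 * b * g)"
proof -
  obtain c where "c \<noteq> 0" "[dl (c * 1) = e] (mod int p)"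
    using dl_surj[of 1 e] by auto
  then have "inj_on (\<lambda>(x, k). x + c * k) (T \<times> K)"
    using class_free_inj[OF T] by simp
  then have "card (T \<times> K) \<le> CARD('k)"
    by (rule card_inj_on_le) auto
  then show ?thesis by (simp add: card_cartesian_product card_K card_field)
qed

text \<open>Equality turns the packing by translates of \<open>\<mu> * z * K\<close> into a tiling
  of the field. Since \<open>\<mu>\<close> lies in \<open>L\<close>, it restricts to a tiling of
  each line in direction \<open>z\<close>, leaving \<open>|L| / |K|\<close> points.\<close>

lemma class_free_meets_line:
  assumes T: "class_free e T" and eq: "card T * 2 ^ b = 2 ^ (2 * b * g)" and z: "z \<noteq> 0"
  shows "card {\<nu> \<in> L. x0 + \<nu> * z \<in> T} = 2 ^ b"
proof -
  obtain \<mu> where \<mu>: "\<mu> \<noteq> 0" "\<mu> \<in> L" "[dl (\<mu> * z) = e] (mod int p)"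
    using dl_surj[OF z, of e] by auto
  have inj: "inj_on (\<lambda>(x, k). x + \<mu> * z * k) (T \<times> K)"
    using class_free_inj[OF T, of "\<mu> * z"] \<mu> z by simp
  have surj: "(\<lambda>(x, k). x + \<mu> * z * k) ` (T \<times> K) = UNIV"
    using eq by (intro card_subset_eq) (auto simp: card_image[OF inj] card_cartesian_product card_K card_field)
  let ?A = "{\<nu> \<in> L. x0 + \<nu> * z \<in> T}"
  have "bij_betw (\<lambda>(\<nu>, k). \<nu> + \<mu> * k) (?A \<times> K) L"
    unfolding bij_betw_def
  proof
    show "inj_on (\<lambda>(\<nu>, k). \<nu> + \<mu> * k) (?A \<times> K)"
    proof (rule inj_onI, clarify)
      fix x k x' k' assume a: "x0 + x * z \<in> T" "x0 + x' * z \<in> T"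
        "k ^ (2 ^ b) = k" "k' ^ (2 ^ b) = k'" and e: "x + \<mu> * k = x' + \<mu> * k'"
      have "(x0 + x * z) + \<mu> * z * k = x0 + (x + \<mu> * k) * z" by (simp add: algebra_simps)
      also have "\<dots> = (x0 + x' * z) + \<mu> * z * k'" unfolding e by (simp add: algebra_simps)
      finally have "(x0 + x * z, k) = (x0 + x' * z, k')"
        using inj_onD[OF inj, of "(x0 + x * z, k)" "(x0 + x' * z, k')"] a by simp
      then show "x = x' \<and> k = k'" using z by simp
    qed
    show "(\<lambda>(\<nu>, k). \<nu> + \<mu> * k) ` (?A \<times> K) = L"
    proof (intro equalityI subsetI)
      fix v assume "v \<in> (\<lambda>(\<nu>, k). \<nu> + \<mu> * k) ` (?A \<times> K)"
      then obtain l k where v: "v = l + \<mu> * k" and l: "l \<in> L" and k: "k \<in> K" by auto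
      have "k \<in> L" using k K_subset_L by blast
      then show "v \<in> L" unfolding v by (intro add_L l mult_L \<mu>(2))
    next
      fix v assume v: "v \<in> L"
      have "x0 + v * z \<in> (\<lambda>(x, k). x + \<mu> * z * k) ` (T \<times> K)" unfolding surj by simp
      then obtain x k where x: "x \<in> T" "k \<in> K" "x0 + v * z = x + \<mu> * z * k" by auto
      \<comment> \<open>In characteristic 2 this is \<open>v - \<mu> * k\<close>, the parameter on
        the line of the point \<open>x\<close> of \<open>T\<close> whose translate covers
        \<open>v\<close>.\<close>
      define l where "l = v + \<mu> * k"
      have mk: "\<mu> * k + \<mu> * k = 0" by (metis add.right_inverse uminus_char2)
      have "k \<in> L" using x(2) K_subset_L by blast
      then have l: "l \<in> L" unfolding l_def by (intro add_L v mult_L \<mu>(2))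
      have "x0 + l * z = x + (\<mu> * k + \<mu> * k) * z"
        using x(3) by (simp add: l_def algebra_simps)
      then have "x0 + l * z = x" by (simp add: mk)
      moreover have "v = l + \<mu> * k" using mk by (simp add: l_def add.assoc)
      ultimately show "v \<in> (\<lambda>(\<nu>, k). \<nu> + \<mu> * k) ` (?A \<times> K)"
        using x l by (intro image_eqI[of _ _ "(l, k)"]) auto
    qed
  qed
  then have "card (?A \<times> K) = card L" by (rule bij_betw_same_card)
  then have "card ?A * 2 ^ b = 2 ^ (2 * b)"
    by (simp only: card_cartesian_product card_K card_L)
  then have "card ?A * 2 ^ b = 2 ^ b * 2 ^ b"
    by (simp only: mult_2 power_add)
  then show ?thesis by simp
qed

lemma class_free_tight:
  assumes T: "class_free e T" and eq: "card T * 2 ^ b = 2 ^ (2 * b * g)"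
  shows "g = 1"
proof -
  have "card T > 0" using eq by (metis mult_zero_left power_not_zero zero_neq_numeral gr0I)
  then obtain x0 where x0: "x0 \<in> T" by fastforce
  \<comment> \<open>Pairing every nonzero vector \<open>z\<close> with every nonzero
    \<open>\<nu>\<close> counts each other point of \<open>T\<close> exactly \<open>|L| - 1\<close>
    times, so no representatives of the lines have to be chosen.\<close>
  let ?P = "SIGMA z : UNIV - {0}. {\<nu> \<in> L. x0 + \<nu> * z \<in> T} - {0}"
  have "card ({\<nu> \<in> L. x0 + \<nu> * z \<in> T} - {0}) = 2 ^ b - 1" if "z \<noteq> 0" for z
    using class_free_meets_line[OF T eq that, of x0] x0 by (subst card_Diff_singleton) auto
  then have 1: "card ?P = (2 ^ (2 * b * g) - 1) * (2 ^ b - 1)"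
    by (subst card_SigmaI) (auto simp: card_field card_Diff_singleton)
  have "bij_betw (\<lambda>(z, l). (x0 + l * z, l)) ?P ((T - {x0}) \<times> (L - {0}))"
    by (rule bij_betw_byWitness[where f' = "\<lambda>(y, l). ((y - x0) / l, l)"]) auto
  then have "card ?P = card ((T - {x0}) \<times> (L - {0}))" by (rule bij_betw_same_card)
  also have "\<dots> = (card T - 1) * (2 ^ (2 * b) - 1)"
    using x0 by (simp add: card_cartesian_product card_L card_Diff_singleton)
  also have "\<dots> = (card T - 1) * p * (2 ^ b - 1)" by (simp only: square_minus_one mult.assoc)
  finally have "(card T - 1) * p * (2 ^ b - 1) = (2 ^ (2 * b * g) - 1) * (2 ^ b - 1)"
    using 1 by simp
  then have "(card T - 1) * p = 2 ^ (2 * b * g) - 1" using field_sizes_gt1(1) by simp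
  moreover have "card T * p = 2 ^ (2 * b * g) + card T" by (simp add: p_eq eq)
  ultimately have "2 ^ (2 * b * g) + card T - p = 2 ^ (2 * b * g) - 1"
    by (simp only: diff_mult_distrib mult_1)
  \<comment> \<open>Comparing the two values of \<open>card T * p\<close> leaves
    \<open>card T = p - 1\<close>.\<close>
  then have "card T = 2 ^ b"
    using field_sizes_gt1(3) unfolding p_eq by linarith
  then have "(2::nat) ^ (2 * b) = 2 ^ (2 * b * g)"
    using eq by (simp add: mult_2 power_add)
  then have "2 * b = 2 * b * g" by (simp only: power_inject_exp[of "2::nat"])
  then show ?thesis using b by simp
qed

lemma dl_inverse:
  assumes "x \<noteq> 0"
  shows "[dl (1 / x) = - dl x] (mod int p)"
proof -
  have "[dl (1 / x) + dl x = dl 1] (mod int p)"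
    using dl_mult[of "1 / x" x] assms by (simp add: cong_sym_eq)
  moreover have "[dl 1 = 0] (mod int p)"
    using dl_power[of 0] by simp
  ultimately have "[dl (1 / x) + dl x = 0] (mod int p)" by (rule cong_trans)
  then show ?thesis by (simp add: cong_iff_dvd_diff)
qed

lemma dl_diff_commute: "dl (x - y) = dl (y - x)"
  by (metis minus_diff_eq uminus_char2)

section \<open>Adjacency in terms of labels\<close>

abbreviation "G \<equiv> ms_graph (2 * b * g) p w"

text \<open>Adjacency up to congruence, so that the labels need not be reduced modulo \<open>p\<close>.\<close>

fun adj :: "'k option \<times> int \<Rightarrow> 'k option \<times> int \<Rightarrow> bool" where
  "adj (None, r) (None, t) \<longleftrightarrow> False"
| "adj (None, r) (Some y, t) \<longleftrightarrow> [r = t] (mod int p)"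
| "adj (Some x, r) (None, t) \<longleftrightarrow> [r = t] (mod int p)"
| "adj (Some x, r) (Some y, t) \<longleftrightarrow> x \<noteq> y \<and> [dl (x - y) = r + t] (mod int p)"

lemma adj_sym: "adj u v \<longleftrightarrow> adj v u"
  by (cases "(u, v)" rule: adj.cases)
    (auto simp: cong_sym_eq dl_diff_commute add.commute)

lemma mod_eq_iff_cong: "0 \<le> t \<Longrightarrow> t < int p \<Longrightarrow> t = r mod int p \<longleftrightarrow> [t = r] (mod int p)"
  by (simp add: cong_def)

text \<open>An exponent \<open>i\<close> with \<open>w ^ i = y - x\<close> contributes
  \<open>2 * i\<close>, which is the label of \<open>y - x\<close> modulo \<open>p\<close>.\<close>

lemma arcs_iff_adj:
  assumes "u \<in> ms_vertices p" "v \<in> ms_vertices p"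
  shows "(u, v) \<in> parcs G \<longleftrightarrow> adj u v"
proof (cases "(u, v)" rule: adj.cases)
  case (4 x r y t)
  have t: "0 \<le> t" "t < int p" using assms 4 by (auto simp: ms_vertices_def)
  have "(u, v) \<in> parcs G \<longleftrightarrow>
      (\<exists>i<2 ^ (2 * b * g) - 1. y = x + w ^ i \<and> [t = - r + 2 * int i] (mod int p))"
    using assms 4 t by (auto simp: ms_graph_def mod_eq_iff_cong)
  also have "\<dots> \<longleftrightarrow> x \<noteq> y \<and> [t = - r + dl (y - x)] (mod int p)"
  proof
    assume "\<exists>i<2 ^ (2 * b * g) - 1. y = x + w ^ i \<and> [t = - r + 2 * int i] (mod int p)"
    then obtain i where i: "y = x + w ^ i" "[t = - r + 2 * int i] (mod int p)" by blast
    have "[t = - r + dl (w ^ i)] (mod int p)"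
      using i(2) cong_add[OF cong_refl[of "- r"] dl_power[of i]] by (simp add: cong_def)
    then show "x \<noteq> y \<and> [t = - r + dl (y - x)] (mod int p)"
      using i(1) primitive_element_nonzero[OF w] by simp
  next
    assume a: "x \<noteq> y \<and> [t = - r + dl (y - x)] (mod int p)"
    then obtain i where i: "i < 2 ^ (2 * b * g) - 1" "w ^ i = y - x"
      using power_exists_less[of "y - x"] by auto
    have "[t = - r + 2 * int i] (mod int p)"
      using a cong_add[OF cong_refl[of "- r"] dl_power[of i]] unfolding i(2) by (simp add: cong_def)
    then show "\<exists>i<2 ^ (2 * b * g) - 1. y = x + w ^ i \<and> [t = - r + 2 * int i] (mod int p)"
      using i by (intro exI[of _ i]) simp
  qed
  also have "\<dots> \<longleftrightarrow> x \<noteq> y \<and> [dl (x - y) = r + t] (mod int p)"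
    by (simp add: cong_iff_dvd_diff dl_diff_commute[of x y] dvd_diff_commute algebra_simps)
  finally show ?thesis using 4 by simp
qed (use assms in \<open>auto simp: ms_graph_def ms_vertices_def cong_def\<close>)

lemma independent_iff:
  "independent_set G S \<longleftrightarrow> S \<subseteq> ms_vertices p \<and> (\<forall>u\<in>S. \<forall>v\<in>S. \<not> adj u v)"
proof -
  have "pverts G = ms_vertices p" by (simp add: ms_graph_def)
  then show ?thesis
    unfolding independent_set_def using arcs_iff_adj by blast
qed

section \<open>Automorphisms moving a finite point to infinity\<close>

text \<open>The automorphism induced by \<open>x \<mapsto> 1 / (x - z)\<close>; the shift of the labels is dictated by
  \<open>1 / x - 1 / y = (y - x) / (x y)\<close>.\<close>

fun move :: "'k \<Rightarrow> 'k option \<times> int \<Rightarrow> 'k option \<times> int" where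
  "move z (None, r) = (Some 0, (- r) mod int p)"
| "move z (Some x, r) =
    (if x = z then (None, (- r) mod int p) else (Some (1 / (x - z)), (r - dl (x - z)) mod int p))"

lemma cong_mod_simps:
  "[r mod m = t] (mod m) \<longleftrightarrow> [r = t] (mod m)"
  "[r = t mod m] (mod m) \<longleftrightarrow> [r = t] (mod m)"
  "[r mod m + t = e] (mod m) \<longleftrightarrow> [r + t = e] (mod m)"
  "[r + t mod m = e] (mod m) \<longleftrightarrow> [r + t = e] (mod m)"
  "[e = r mod m + t] (mod m) \<longleftrightarrow> [e = r + t] (mod m)"
  "[e = r + t mod m] (mod m) \<longleftrightarrow> [e = r + t] (mod m)"
  for r t e m :: int
  by (simp_all add: cong_def mod_simps)

lemma dl_diff_inverse:
  assumes "x \<noteq> 0" "y \<noteq> 0" "x \<noteq> y"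
  shows "[dl (1 / x - 1 / y) = dl (x - y) - dl x - dl y] (mod int p)"
proof -
  have "1 / x - 1 / y = (y - x) * (1 / x * (1 / y))" using assms by (simp add: field_simps)
  then have "[dl (1 / x - 1 / y) = dl (y - x) + dl (1 / x * (1 / y))] (mod int p)"
    using dl_mult[of "y - x" "1 / x * (1 / y)"] assms by simp
  also have "[dl (y - x) + dl (1 / x * (1 / y)) = dl (y - x) + (dl (1 / x) + dl (1 / y))] (mod int p)"
    using assms by (intro cong_add cong_refl dl_mult) auto
  also have "[dl (y - x) + (dl (1 / x) + dl (1 / y)) = dl (y - x) + (- dl x + - dl y)] (mod int p)"
    using assms by (intro cong_add cong_refl dl_inverse)
  finally show ?thesis by (simp add: dl_diff_commute[of x y] algebra_simps)
qed

text \<open>The image of infinity has field coordinate 0, and the label of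
  \<open>0 - 1 / (y - z)\<close> is exactly the shift applied to \<open>t\<close>.\<close>

lemma adj_move_infinity: "adj (move z (None, r)) (move z v) \<longleftrightarrow> adj (None, r) v"
proof (cases v)
  case (Pair y t)
  show ?thesis
  proof (cases "y = None \<or> y = Some z")
    case True
    then show ?thesis using Pair
      by (auto simp: cong_mod_simps cong_minus_minus_iff)
  next
    case False
    then obtain y' where y: "y = Some y'" "y' \<noteq> z" by auto
    have "[dl (0 - 1 / (y' - z)) = - dl (y' - z)] (mod int p)"
      using dl_inverse[of "y' - z"] y(2) by (simp add: uminus_char2)
    then have "[dl (0 - 1 / (y' - z)) = - r + (t - dl (y' - z))] (mod int p) \<longleftrightarrow>
        [- dl (y' - z) = - r + (t - dl (y' - z))] (mod int p)"
      by (meson cong_sym cong_trans)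
    also have "\<dots> \<longleftrightarrow> [r = t] (mod int p)"
      by (simp add: cong_iff_dvd_diff algebra_simps)
    finally show ?thesis using Pair y by (simp add: cong_mod_simps)
  qed
qed

lemma adj_move: "adj (move z u) (move z v) \<longleftrightarrow> adj u v"
proof (cases "fst u = None \<or> fst v = None")
  case True
  then show ?thesis
    by (metis adj_move_infinity adj_sym prod.collapse)
next
  case False
  then obtain x r y t where uv: "u = (Some x, r)" "v = (Some y, t)"
    by (metis option.collapse prod.collapse)
  have *: "[- r = t - d] (mod int p) \<longleftrightarrow> [d = r + t] (mod int p)"
    "[r - d = - t] (mod int p) \<longleftrightarrow> [d = r + t] (mod int p)" for d
    by (simp_all add: cong_iff_dvd_diff dvd_diff_commute algebra_simps)
  show ?thesis
  proof (cases "x = z \<or> y = z")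
    case True
    then show ?thesis
      by (auto simp: uv cong_mod_simps * dl_diff_commute)
  next
    case False
    let ?x = "x - z" and ?y = "y - z"
    show ?thesis
    proof (cases "x = y")
      case ne: False
      have "[dl (1 / ?x - 1 / ?y) = dl (x - y) - dl ?x - dl ?y] (mod int p)"
        using dl_diff_inverse[of ?x ?y] False ne by simp
      then have "[dl (1 / ?x - 1 / ?y) = r - dl ?x + (t - dl ?y)] (mod int p) \<longleftrightarrow>
          [dl (x - y) - dl ?x - dl ?y = r - dl ?x + (t - dl ?y)] (mod int p)"
        by (meson cong_sym cong_trans)
      also have "\<dots> \<longleftrightarrow> [dl (x - y) = r + t] (mod int p)"
        by (simp add: cong_iff_dvd_diff algebra_simps)
      finally show ?thesis using False ne by (simp add: uv cong_mod_simps)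
    qed (use False in \<open>simp add: uv\<close>)
  qed
qed

lemma move_vertex: "move z u \<in> ms_vertices p"
  using p_gt1 by (cases "(z, u)" rule: move.cases) (auto simp: ms_vertices_def)

text \<open>Images determine labels only modulo \<open>p\<close>, hence the restriction to vertices,
  whose labels are reduced.\<close>

lemma inj_on_move: "inj_on (move z) (ms_vertices p)"
proof (rule inj_onI)
  fix u v assume u: "u \<in> ms_vertices p" and v: "v \<in> ms_vertices p" and eq: "move z u = move z v"
  obtain x r y t where uv: "u = (x, r)" "v = (y, t)" by fastforce
  have xy: "x = y"
    using eq by (cases x; cases y) (auto simp: uv split: if_splits)
  then have "[r = t] (mod int p)"
    using eq by (cases y)
      (auto simp: uv cong_iff_dvd_diff mod_eq_dvd_iff dvd_diff_commute split: if_splits)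
  then show "u = v"
    using u v xy by (auto simp: uv ms_vertices_def cong_def)
qed

lemma independent_move:
  assumes "independent_set G S"
  shows "independent_set G (move z ` S)" "card (move z ` S) = card S"
proof -
  have S: "S \<subseteq> ms_vertices p" using assms by (simp add: independent_iff)
  show "independent_set G (move z ` S)"
    using assms by (auto simp: independent_iff adj_move move_vertex)
  show "card (move z ` S) = card S"
    using S inj_on_move by (metis card_image inj_on_subset)
qed

section \<open>Bounding independent sets layer by layer\<close>

text \<open>\<open>B\<close> stays abstract because the bound is applied twice: with the packing
  bound, and with one less when no layer can be tight.\<close>

lemma independent_card_infinity:
  assumes S: "independent_set G S" and inf: "(None, r0) \<in> S"
    and B: "\<And>e T. class_free e T \<Longrightarrow> card T \<le> B" "1 \<le> B"
  shows "card S \<le> 1 + 2 ^ b * B"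
proof -
  have verts: "S \<subseteq> ms_vertices p" and nadj: "\<And>u v. u \<in> S \<Longrightarrow> v \<in> S \<Longrightarrow> \<not> adj u v"
    using S by (auto simp: independent_iff)
  let ?R = "{0..<int p}"
  define D where "D = {r. (None, r) \<in> S}"
  define T where "T r = {x. (Some x, r) \<in> S}" for r
  have D: "D \<subseteq> ?R" using verts by (auto simp: D_def ms_vertices_def)
  then have finD: "finite D" by (rule finite_subset) simp
  have Dp: "1 \<le> card D" using inf finD by (auto simp: D_def Suc_le_eq card_gt_0_iff)
  have "class_free (2 * r) (T r)" for r
    using nadj[of "(Some _, r)" "(Some _, r)"] by (auto simp: class_free_def T_def)
  then have cardT: "card (T r) \<le> B" for r by (rule B(1))
  have "S \<subseteq> (\<lambda>r. (None, r)) ` D \<union> (\<lambda>(r, x). (Some x, r)) ` (SIGMA r : ?R - D. T r)"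
  proof
    fix u assume u: "u \<in> S"
    obtain x r where xr: "u = (x, r)" by fastforce
    have r: "r \<in> ?R" using u verts by (auto simp: xr ms_vertices_def)
    show "u \<in> (\<lambda>r. (None, r)) ` D \<union> (\<lambda>(r, x). (Some x, r)) ` (SIGMA r : ?R - D. T r)"
    proof (cases x)
      case (Some y)
      then have "r \<notin> D" using nadj[of "(None, r)" u] u by (auto simp: D_def xr)
      then show ?thesis using u r Some by (force simp: xr T_def)
    qed (use u in \<open>auto simp: xr D_def\<close>)
  qed
  then have "card S \<le> card ((\<lambda>r. (None :: 'k option, r)) ` D \<union> (\<lambda>(r, x). (Some x, r)) ` (SIGMA r : ?R - D. T r))"
    by (rule card_mono[rotated]) (use finD in simp)
  also have "\<dots> \<le> card ((\<lambda>r. (None :: 'k option, r)) ` D) + card ((\<lambda>(r, x). (Some x, r)) ` (SIGMA r : ?R - D. T r))"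
    by (rule card_Un_le)
  also have "\<dots> \<le> card D + card (SIGMA r : ?R - D. T r)"
    by (intro add_mono card_image_le finD) simp
  also have "card (SIGMA r : ?R - D. T r) = (\<Sum>r\<in>?R - D. card (T r))" by simp
  also have "\<dots> \<le> card (?R - D) * B"
    using sum_bounded_above[of "?R - D" "\<lambda>r. card (T r)" B] cardT by simp
  also have "card (?R - D) = p - card D" using D finD by (simp add: card_Diff_subset)
  \<comment> \<open>Each further point at infinity adds one vertex but costs a layer worth
    \<open>B\<close>, so \<open>1 \<le> B\<close> makes a single such point the worst case.\<close>
  also have "card D + (p - card D) * B \<le> 1 + 2 ^ b * B"
  proof -
    obtain m where m: "card D = Suc m" using Dp by (cases "card D") auto
    have "Suc m \<le> p" using card_mono[OF _ D] m by simp
    then obtain n where n: "p = Suc m + n" using le_Suc_ex by blast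
    then have "2 ^ b = m + n" by (simp add: p_eq)
    moreover have "m \<le> m * B" using B(2) by simp
    ultimately show ?thesis by (simp add: m n add_mult_distrib)
  qed
  finally show ?thesis by simp
qed

lemma independent_card:
  assumes S: "independent_set G S"
    and B: "\<And>e T. class_free e T \<Longrightarrow> card T \<le> B" "1 \<le> B"
  shows "card S \<le> 1 + 2 ^ b * B"
proof (cases "S = {}")
  case False
  then obtain x r where xr: "(x, r) \<in> S" by fastforce
  show ?thesis
  proof (cases x)
    case None
    then show ?thesis using independent_card_infinity[OF S] xr B by blast
  next
    case (Some z)
    then have "(None, (- r) mod int p) \<in> move z ` S"
      using xr by (force intro: rev_image_eqI)
    then show ?thesis
      using independent_card_infinity[OF independent_move(1)[OF S]] B
      unfolding independent_move(2)[OF S] by blast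
  qed
qed simp

lemma independence_number_attained:
  "\<exists>S. independent_set G S \<and> card S = independence_number G"
proof -
  have "finite (ms_vertices p :: ('k option \<times> int) set)" by (simp add: ms_vertices_def)
  then have "finite {S. independent_set G S}"
    by (rule finite_subset[rotated, OF finite_Pow_iff[THEN iffD2]]) (auto simp: independent_iff)
  moreover have "{} \<in> {S. independent_set G S}" by (simp add: independent_iff)
  ultimately have "independence_number G \<in> card ` {S. independent_set G S}"
    unfolding independence_number_def by (intro Max_in) auto
  then show ?thesis by auto
qed

lemma independence_number_bound:
  "independence_number G \<le> 2 ^ (2 * b * g) + 1"
  "independence_number G = 2 ^ (2 * b * g) + 1 \<Longrightarrow> g = 1"
proof -
  obtain S where S: "independent_set G S" "card S = independence_number G"
    using independence_number_attained by blast
  define B :: nat where "B = 2 ^ (2 * b * g - b)"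
  have "b < 2 * b * g" using b g by (cases g) auto
  then have B_mult: "2 ^ b * B = 2 ^ (2 * b * g)"
    by (simp add: B_def flip: power_add)
  have le: "card T \<le> B" if "class_free e T" for e T
    using class_free_card[OF that] unfolding B_mult[symmetric] by simp
  show "independence_number G \<le> 2 ^ (2 * b * g) + 1"
    using independent_card[OF S(1) le] S(2) by (simp add: B_mult) (simp add: B_def)
  assume eq: "independence_number G = 2 ^ (2 * b * g) + 1"
  show "g = 1"
  proof (rule ccontr)
    assume g1: "g \<noteq> 1"
    have "card T \<le> B - 1" if T: "class_free e T" for e T
    proof -
      have "card T \<noteq> B"
        using class_free_tight[OF T] g1 unfolding B_mult[symmetric] by auto
      then show ?thesis using le[OF T] by simp
    qed
    \<comment> \<open>Strictness ensures that \<open>B - 1\<close> is still at least 1, as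
      \<open>independent_card\<close> demands.\<close>
    moreover have "1 < B"
      unfolding B_def using \<open>b < 2 * b * g\<close> by (intro one_less_power) auto
    ultimately have "card S \<le> 1 + 2 ^ b * (B - 1)"
      by (intro independent_card[OF S(1)]) auto
    also have "\<dots> < 1 + 2 ^ b * B" using \<open>1 < B\<close> by simp
    finally show False using eq S(2) B_mult by simp
  qed
qed

end

theorem theorem5p8:
  fixes s a q p l :: nat
    and w :: "'k::{field,finite}"
  assumes "s \<ge> 1"
    and "a = 2 ^ s"
    and "q = 2 ^ a + 1"
    and "fermat_prime q"
    and "prime p"
    and "p dvd 2 ^ a - 1"
    and "l \<le> s - 1"
    and "p = 2 ^ (2 ^ l) + 1"
    and "fermat_prime p"
    and "CARD('k) = 2 ^ a"
    and "primitive_element w"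
  shows "independence_number (ms_graph a p w) \<le> q \<and>
    (independence_number (ms_graph a p w) = q \<longrightarrow> l = s - 1 \<and> p = 2 ^ (2 ^ (s - 1)) + 1)"
proof -
  \<comment> \<open>The exponent makes \<open>2 * 2 ^ l * g = a\<close>. As a power of two,
    \<open>g\<close> is coprime to the odd \<open>p\<close>, and \<open>g = 1\<close> means
    \<open>l = s - 1\<close>.\<close>
  define g :: nat where "g = 2 ^ (s - 1 - l)"
  have "2 * 2 ^ l * g = 2 ^ Suc (l + (s - 1 - l))" by (simp add: g_def power_add)
  also have "\<dots> = a" using assms by simp
  finally have a: "2 * 2 ^ l * g = a" .
  interpret ms_field w "2 ^ l" g p
    using assms a by unfold_locales (auto simp: g_def)
  have "l = s - 1" if "g = 1"
    using that \<open>l \<le> s - 1\<close> by (simp add: g_def)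
  then show ?thesis
    using independence_number_bound assms unfolding a by auto
qed

end
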